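(* Let $d\ge 2$, let $U$ be an arbitrary unitary on $\mathbb{C}^d$, and for $r\in[0,1]$ let $\mathcal{J}_r(\rho)=r\rho+(1-r)U\rho U^\dagger$. For any $r_1,r_2\in[0,1]$, a single-system probe is sufficient to distinguish $\mathcal{J}_{r_1}$ and $\mathcal{J}_{r_2}$ optimally: the maximum of the success probability over single-system probes equals its maximum over all probes, including entangled probes with an arbitrary ancilla.
   Context: Two channels $\mathcal{N}_1,\mathcal{N}_2$ on $\mathbb{C}^d$, chosen with equal priors $1/2$, are discriminated in a single shot. A single-system probe is a state $\rho$ on $\mathbb{C}^d$ with success probability $\frac12+\frac14\|\mathcal{N}_1(\rho)-\mathcal{N}_2(\rho)\|_1$; a general (possibly entangled) probe is a state $\rho_{AB}$ on $\mathbb{C}^d\otimes\mathbb{C}^{d'}$ (any finite $d'$) with the channel acting on $A$, with success probability $\frac12+\frac14\|(\mathcal{N}_1\otimes\mathrm{id})(\rho_{AB})-(\mathcal{N}_2\otimes\mathrm{id})(\rho_{AB})\|_1$; $\|\cdot\|_1$ is the trace norm. *)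

theory Defs
  imports Complex_Main "Jordan_Normal_Form.Matrix" "Jordan_Normal_Form.Schur_Decomposition"
begin

definition mtrace :: "complex mat \<Rightarrow> complex" where
  "mtrace A = (\<Sum>i<dim_row A. A $$ (i,i))"

definition psd :: "nat \<Rightarrow> complex mat \<Rightarrow> bool" where
  "psd n A \<longleftrightarrow> A \<in> carrier_mat n n \<and> mat_adjoint A = A \<and>
     (\<forall>v \<in> carrier_vec n. 0 \<le> Re ((A *\<^sub>v v) \<bullet>c v))"

definition density :: "nat \<Rightarrow> complex mat \<Rightarrow> bool" where
  "density n \<rho> \<longleftrightarrow> psd n \<rho> \<and> mtrace \<rho> = 1"

definition unitary_mat :: "nat \<Rightarrow> complex mat \<Rightarrow> bool" where
  "unitary_mat n U \<longleftrightarrow> U \<in> carrier_mat n n \<and> mat_adjoint U * U = 1\<^sub>m n"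

definition trace_norm :: "complex mat \<Rightarrow> real" where
  "trace_norm A = Re (mtrace (THE B. psd (dim_col A) B \<and> B * B = mat_adjoint A * A))"

text \<open>(N \<otimes> id) acting on C^d \<otimes> C^d', basis index (i,b) \<mapsto> i*d' + b.\<close>
definition apply_A :: "(complex mat \<Rightarrow> complex mat) \<Rightarrow> nat \<Rightarrow> nat \<Rightarrow> complex mat \<Rightarrow> complex mat" where
  "apply_A N d d' X = mat (d*d') (d*d') (\<lambda>(p,q).
      N (mat d d (\<lambda>(i,j). X $$ (i*d' + p mod d', j*d' + q mod d'))) $$ (p div d', q div d'))"

definition J_chan :: "complex mat \<Rightarrow> real \<Rightarrow> complex mat \<Rightarrow> complex mat" where
  "J_chan U r \<rho> = complex_of_real r \<cdot>\<^sub>m \<rho> + complex_of_real (1 - r) \<cdot>\<^sub>m (U * \<rho> * mat_adjoint U)"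

definition succ_single :: "(complex mat \<Rightarrow> complex mat) \<Rightarrow> (complex mat \<Rightarrow> complex mat) \<Rightarrow> complex mat \<Rightarrow> real" where
  "succ_single N1 N2 \<rho> = 1/2 + 1/4 * trace_norm (N1 \<rho> - N2 \<rho>)"

definition succ_ent :: "(complex mat \<Rightarrow> complex mat) \<Rightarrow> (complex mat \<Rightarrow> complex mat) \<Rightarrow> nat \<Rightarrow> nat \<Rightarrow> complex mat \<Rightarrow> real" where
  "succ_ent N1 N2 d d' \<rho> = 1/2 + 1/4 * trace_norm (apply_A N1 d d' \<rho> - apply_A N2 d d' \<rho>)"

end

theory Submission
  imports Defs "Jordan_Normal_Form.Spectral_Radius" "HOL-Analysis.Starlike"
begin

text \<open>The difference of the two output states is \<open>(r\<^sub>1 - r\<^sub>2) (\<rho> - W \<rho> W\<^sup>\<dagger>)\<close>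
  with \<open>W = U\<close> or \<open>W = U \<otimes> 1\<close>. Decomposing \<open>\<rho>\<close> into pure states shows that
  \<open>\<parallel>\<rho> - W \<rho> W\<^sup>\<dagger>\<parallel>\<^sub>1 \<le> 2 sqrt (1 - \<nu>\<^sup>2)\<close>, where \<open>\<nu>\<close> is the minimum of
  \<open>\<bar>\<langle>\<psi>, W \<psi>\<rangle>\<bar>\<close> over unit vectors, and a minimizing pure state attains the bound.
  Since \<open>U\<close> is normal, its numerical range is the convex hull of its eigenvalues, and
  \<open>U \<otimes> 1\<close> has the same eigenvalues. Hence \<open>\<nu>\<close> is the same with and without ancilla.\<close>

text \<open>The trace norm is a definite description of a positive square root, so it can be
  evaluated only once such a root is known to exist and to be unique; this is why unitary
  diagonalization is established first. The value \<open>sqrt (1 - \<nu>\<^sup>2)\<close> comes from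
  pairs of unit vectors: the difference of their projections has trace zero and rank at most two,
  and its eigenvalues are plus and minus the root of 1 minus the squared modulus of the inner
  product. Mixed states need no triangle inequality for the trace norm: each eigenvalue of the
  difference is a weighted sum of real numbers, and the scalar inequality is enough. A minimizing
  vector can be written down because a convex combination of eigenvalues is the expectation of
  \<open>U\<close> in the vector whose amplitudes are the square roots of the weights. With an
  ancilla, weights of equal system index are added up, which gives a convex combination of the same
  eigenvalues.\<close>

no_notation inner (infix "\<bullet>" 70)

section \<open>Adjoints, products and unitary matrices\<close>

lemma mat_adjoint_dims [simp]:
  "dim_row (mat_adjoint A) = dim_col A" "dim_col (mat_adjoint A) = dim_row A"
  by (auto simp: mat_adjoint_def)

lemma mat_adjoint_carrier [simp]: "A \<in> carrier_mat n m \<Longrightarrow> mat_adjoint A \<in> carrier_mat m n"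
  by (rule carrier_matI) auto

lemma mat_adjoint_index [simp]:
  fixes A :: "complex mat"
  shows "i < dim_col A \<Longrightarrow> j < dim_row A \<Longrightarrow> mat_adjoint A $$ (i,j) = cnj (A $$ (j,i))"
  by (simp add: mat_adjoint_def mat_of_rows_def)

lemma mat_mult_index:
  assumes "A \<in> carrier_mat n m" "B \<in> carrier_mat m k" "i < n" "j < k"
  shows "(A * B) $$ (i,j) = (\<Sum>l<m. A $$ (i,l) * B $$ (l,j))"
  using assms by (auto simp: scalar_prod_def atLeast0LessThan)

lemma mat_adjoint_adjoint [simp]: "mat_adjoint (mat_adjoint A) = (A :: complex mat)"
  by (rule eq_matI) auto

lemma mat_adjoint_mult:
  fixes A B :: "complex mat"
  assumes "A \<in> carrier_mat n m" "B \<in> carrier_mat m k"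
  shows "mat_adjoint (A * B) = mat_adjoint B * mat_adjoint A"
proof (rule eq_matI)
  fix i j assume "i < dim_row (mat_adjoint B * mat_adjoint A)" "j < dim_col (mat_adjoint B * mat_adjoint A)"
  then show "mat_adjoint (A * B) $$ (i, j) = (mat_adjoint B * mat_adjoint A) $$ (i, j)"
    using assms by (auto simp: scalar_prod_def mult.commute intro!: sum.cong)
qed (use assms in auto)

lemma mat_adjoint_one [simp]: "mat_adjoint (1\<^sub>m n) = (1\<^sub>m n :: complex mat)"
  by (rule eq_matI) auto

lemma mat_adjoint_diag [simp]:
  "mat_adjoint (mat_diag n l) = mat_diag n (\<lambda>i. cnj (l i))" for l :: "nat \<Rightarrow> complex"
  by (rule eq_matI) (auto simp: mat_diag_def)

lemma mat_adjoint_smult: "mat_adjoint (c \<cdot>\<^sub>m A) = cnj c \<cdot>\<^sub>m mat_adjoint (A :: complex mat)"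
  by (rule eq_matI) auto

lemma mat_adjoint_minus:
  fixes A B :: "complex mat"
  assumes "A \<in> carrier_mat n m" "B \<in> carrier_mat n m"
  shows "mat_adjoint (A - B) = mat_adjoint A - mat_adjoint B"
  using assms by (intro eq_matI) auto

lemma mult_carrier_square [simp]:
  "A \<in> carrier_mat n n \<Longrightarrow> B \<in> carrier_mat n n \<Longrightarrow> A * B \<in> carrier_mat n n"
  by (rule mult_carrier_mat)

(* The inner dimension is schematic in the premises of these rules, which makes simp search blow up. *)
declare mult_carrier_mat [simp del] assoc_mult_mat [simp del]

lemma unitary_matD:
  assumes "unitary_mat n U"
  shows "U \<in> carrier_mat n n" "mat_adjoint U * U = 1\<^sub>m n" "U * mat_adjoint U = 1\<^sub>m n"
proof -
  show U: "U \<in> carrier_mat n n" and UU: "mat_adjoint U * U = 1\<^sub>m n"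
    using assms by (auto simp: unitary_mat_def)
  show "U * mat_adjoint U = 1\<^sub>m n"
    using mat_mult_left_right_inverse[OF _ U UU] U by simp
qed

lemma unitary_mat_adjoint: "unitary_mat n U \<Longrightarrow> unitary_mat n (mat_adjoint U)"
  unfolding unitary_mat_def[of n "mat_adjoint U"] by (simp add: unitary_matD)

text \<open>Once products are nested to the right, a factor and its inverse meet only in the shape
  \<open>A * (B * C)\<close>; this is the cancellation rule for that normal form.\<close>

lemma mult_left_cancel_mat:
  fixes A B C :: "complex mat"
  assumes "A * B = 1\<^sub>m n" "A \<in> carrier_mat n n" "B \<in> carrier_mat n n" "C \<in> carrier_mat n n"
  shows "A * (B * C) = C"
proof -
  have "A * (B * C) = (A * B) * C" by (rule assoc_mult_mat[symmetric]) fact+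
  then show ?thesis using assms by simp
qed

lemma unitary_mat_mult:
  assumes "unitary_mat n U" "unitary_mat n V"
  shows "unitary_mat n (U * V)"
  using unitary_matD[OF assms(1)] unitary_matD[OF assms(2)]
  by (auto simp: unitary_mat_def mat_adjoint_mult[of _ n n _ n] mult_left_cancel_mat[of _ _ n] assoc_mult_mat[of _ n n _ n _ n])

lemma unitary_mat_col:
  assumes U: "unitary_mat n U" and "m < n"
  shows "(\<Sum>k<n. (cmod (U $$ (k,m)))\<^sup>2) = 1"
proof -
  note UD = unitary_matD[OF U]
  have "complex_of_real (\<Sum>k<n. (cmod (U $$ (k,m)))\<^sup>2) = (mat_adjoint U * U) $$ (m,m)"
    using UD(1) assms(2)
    by (subst mat_mult_index[of _ n n _ n]) (auto simp: complex_norm_square mult.commute simp del: of_real_power intro!: sum.cong)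
  also have "\<dots> = 1" using UD assms by simp
  finally show ?thesis by (simp only: of_real_eq_1_iff)
qed

subsection \<open>Unitary diagonalization of normal matrices\<close>

text \<open>The deflation step of the diagonalization. An eigenvector is completed to a basis, and
  Gram-Schmidt keeps the first basis vector, so it survives as column 0 up to scaling.\<close>

lemma eigenvector_first_column:
  fixes A :: "complex mat"
  assumes A: "A \<in> carrier_mat n n" and n: "n > 0"
  obtains V e where "unitary_mat n V" "\<And>i. i < n \<Longrightarrow> (A * V) $$ (i,0) = e * V $$ (i,0)"
proof -
  obtain e where "eigenvalue A e" using spectrum_non_empty[OF A n] by (auto simp: spectrum_def)
  then obtain v where v: "v \<in> carrier_vec n" "v \<noteq> 0\<^sub>v n" "A *\<^sub>v v = e \<cdot>\<^sub>v v"
    using A by (auto simp: eigenvalue_def eigenvector_def)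
  interpret cof_vec_space n "TYPE(complex)" .
  define ws where "ws = gram_schmidt n (basis_completion v)"
  note b = basis_completion[OF v(1,2)]
  have ne: "basis_completion v = v # tl (basis_completion v)"
    using b(6,7) n by (cases "basis_completion v") auto
  have hd: "hd ws = v" unfolding ws_def using gram_schmidt_hd[OF v(1)] ne by metis
  have ws: "set ws \<subseteq> carrier_vec n" "corthogonal ws" "length ws = n"
    using gram_schmidt_result[OF b(2,4,5) ws_def] b(6) by auto
  define W where "W = mat_of_cols n ws"
  have W: "W \<in> carrier_mat n n" using ws by (auto simp: W_def)
  have orth: "corthogonal_mat W" unfolding W_def by (rule orthogonal_mat_of_cols[OF ws])
  have Wv: "W $$ (i,0) = v $ i" if "i < n" for i
  proof -
    have "ws \<noteq> []" using n ws(3) by auto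
    then show ?thesis using that n hd ws(3) by (simp add: W_def mat_of_cols_def hd_conv_nth)
  qed
  \<comment> \<open>\<open>gram_schmidt\<close> gives orthogonal columns, not unit columns. Their
    squared lengths \<open>g\<close> form the diagonal of \<open>mat_adjoint W * W\<close>, and
    dividing by the square roots makes the matrix unitary.\<close>
  define g where "g j = (\<Sum>k<n. (cmod (W $$ (k,j)))\<^sup>2)" for j
  have WW: "(mat_adjoint W * W) $$ (i,j) = (if i = j then of_real (g j) else 0)"
    and g0: "g j \<noteq> 0" if "i < n" "j < n" for i j
  proof -
    have *: "(mat_adjoint W * W) $$ (i,i) = of_real (g i)" if "i < n" for i
      using W that
      by (subst mat_mult_index[of _ n n _ n]) (auto simp: g_def complex_norm_square mult.commute simp del: of_real_power intro!: sum.cong)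
    show "(mat_adjoint W * W) $$ (i,j) = (if i = j then of_real (g j) else 0)"
      using * orth that W by (auto simp: corthogonal_mat_def Let_def diagonal_mat_def simp del: index_mult_mat(1))
    show "g j \<noteq> 0" using *[of j] orth that W by (auto simp: corthogonal_mat_def Let_def simp del: index_mult_mat(1))
  qed
  have gpos: "g j > 0" if "j < n" for j
    using g0[OF that that] by (simp add: g_def order_less_le sum_nonneg)
  define s where "s j = inverse (complex_of_real (sqrt (g j)))" for j
  define V where "V = W * mat_diag n s"
  have V: "V \<in> carrier_mat n n" using W by (simp add: V_def)
  have Vi: "V $$ (i,j) = W $$ (i,j) * s j" if "i < n" "j < n" for i j
    using that W by (simp add: V_def mat_diag_mult_right[of _ n])
  have "mat_adjoint V * V = 1\<^sub>m n"
  proof (rule eq_matI)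
    fix i j assume ij: "i < dim_row (1\<^sub>m n)" "j < dim_col (1\<^sub>m n)"
    have "(mat_adjoint V * V) $$ (i,j) = (\<Sum>l<n. cnj (W $$ (l,i) * s i) * (W $$ (l,j) * s j))"
      using ij V by (subst mat_mult_index[of _ n n _ n]) (auto simp: Vi intro!: sum.cong)
    also have "\<dots> = cnj (s i) * s j * (mat_adjoint W * W) $$ (i,j)"
      using ij W by (subst mat_mult_index[of _ n n _ n]) (auto simp: sum_distrib_left algebra_simps intro!: sum.cong)
    also have "\<dots> = 1\<^sub>m n $$ (i,j)"
    proof -
      have "complex_of_real (sqrt (g j)) * complex_of_real (sqrt (g j)) = of_real (g j)" "g j \<noteq> 0"
        using gpos[of j] ij by (simp_all flip: of_real_mult)
      then show ?thesis using ij by (auto simp: WW s_def field_simps)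
    qed
    finally show "(mat_adjoint V * V) $$ (i,j) = 1\<^sub>m n $$ (i,j)" .
  qed (use V in auto)
  then have "unitary_mat n V" using V by (simp add: unitary_mat_def)
  moreover have "(A * V) $$ (i,0) = e * V $$ (i,0)" if i: "i < n" for i
  proof -
    have "(A * V) $$ (i,0) = (\<Sum>l<n. A $$ (i,l) * v $ l) * s 0"
      using i n V A by (subst mat_mult_index[of _ n n _ n]) (auto simp: Vi Wv sum_distrib_right intro!: sum.cong)
    also have "(\<Sum>l<n. A $$ (i,l) * v $ l) = (A *\<^sub>v v) $ i"
      using i A v(1) by (auto simp: scalar_prod_def atLeast0LessThan intro!: sum.cong)
    finally show ?thesis using i n v by (simp add: Vi Wv)
  qed
  ultimately show ?thesis using that by blast
qed

text \<open>The direct sum of a scalar block and \<open>A\<close>; through it the induction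
  reattaches the eigenvalue that was split off.\<close>

definition bordered :: "complex \<Rightarrow> complex mat \<Rightarrow> complex mat" where
  "bordered c A = Matrix.mat (Suc (dim_row A)) (Suc (dim_col A)) (\<lambda>(i,j).
     case i of 0 \<Rightarrow> (case j of 0 \<Rightarrow> c | Suc _ \<Rightarrow> 0)
     | Suc i' \<Rightarrow> (case j of 0 \<Rightarrow> 0 | Suc j' \<Rightarrow> A $$ (i',j')))"

lemma bordered_carrier [simp]: "A \<in> carrier_mat n m \<Longrightarrow> bordered c A \<in> carrier_mat (Suc n) (Suc m)"
  by (auto simp: bordered_def)

lemma bordered_mult:
  assumes "A \<in> carrier_mat n m" "B \<in> carrier_mat m k"
  shows "bordered a A * bordered b B = bordered (a * b) (A * B)"
  by (rule eq_matI, insert assms)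
     (auto simp: bordered_def scalar_prod_def sum.atLeast0_lessThan_Suc_shift split: nat.splits simp del: sum.op_ivl_Suc)

lemma bordered_adjoint: "mat_adjoint (bordered a A) = bordered (cnj a) (mat_adjoint A)"
  by (rule eq_matI) (auto simp: bordered_def split: nat.splits)

lemma bordered_one: "bordered 1 (1\<^sub>m n) = 1\<^sub>m (Suc n)"
  by (rule eq_matI) (auto simp: bordered_def split: nat.splits)

lemma bordered_diag: "bordered c (mat_diag n l) = mat_diag (Suc n) (case_nat c l)"
  by (rule eq_matI) (auto simp: bordered_def mat_diag_def split: nat.splits)

lemma bordered_inject:
  assumes "bordered a A = bordered b B" "A \<in> carrier_mat n n" "B \<in> carrier_mat n n"
  shows "A = B"
proof (rule eq_matI)
  fix i j assume "i < dim_row B" "j < dim_col B"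
  then show "A $$ (i,j) = B $$ (i,j)"
    using arg_cong[OF assms(1), of "\<lambda>M. M $$ (Suc i, Suc j)"] assms(2,3) by (simp add: bordered_def)
qed (use assms in auto)

lemma normal_conj_unitary:
  fixes A :: "complex mat"
  assumes A: "A \<in> carrier_mat n n" "mat_adjoint A * A = A * mat_adjoint A" and V: "unitary_mat n V"
  defines "B \<equiv> mat_adjoint V * (A * V)"
  shows "mat_adjoint B * B = B * mat_adjoint B"
proof -
  note VD [simp] = unitary_matD[OF V]
  have [simp]: "V * (mat_adjoint V * C) = C" "mat_adjoint V * (V * C) = C" if "C \<in> carrier_mat n n" for C
    using that by (simp_all add: mult_left_cancel_mat[of _ _ n] assoc_mult_mat[of _ n n _ n _ n])
  have "mat_adjoint B * B = mat_adjoint V * (mat_adjoint A * (A * V))"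
    using A(1) by (simp add: B_def mat_adjoint_mult[of _ n n _ n] assoc_mult_mat[of _ n n _ n _ n])
  also have "mat_adjoint A * (A * V) = A * (mat_adjoint A * V)"
    using A by (simp flip: assoc_mult_mat[of _ n n _ n _ n])
  also have "mat_adjoint V * (A * (mat_adjoint A * V)) = B * mat_adjoint B"
    using A(1) by (simp add: B_def mat_adjoint_mult[of _ n n _ n] assoc_mult_mat[of _ n n _ n _ n])
  finally show ?thesis .
qed

text \<open>Induction on the dimension: moving an eigenvector to the first coordinate clears the
  rest of the first column, normality then clears the rest of the first row, and a smaller normal
  block remains.\<close>

theorem normal_mat_unitarily_diagonalizable:
  fixes A :: "complex mat"
  assumes "A \<in> carrier_mat n n" "mat_adjoint A * A = A * mat_adjoint A"
  shows "\<exists>V l. unitary_mat n V \<and> A = V * mat_diag n l * mat_adjoint V"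
  using assms
proof (induction n arbitrary: A)
  case 0
  then show ?case by (intro exI[of _ "1\<^sub>m 0"]) (auto simp: unitary_mat_def intro!: eq_matI)
next
  case (Suc n)
  note A = Suc.prems
  obtain V e where V: "unitary_mat (Suc n) V"
    and ev: "\<And>i. i < Suc n \<Longrightarrow> (A * V) $$ (i,0) = e * V $$ (i,0)"
    using eigenvector_first_column[OF A(1)] by blast
  note VD [simp] = unitary_matD[OF V]
  define B where "B = mat_adjoint V * (A * V)"
  have B: "B \<in> carrier_mat (Suc n) (Suc n)" using A by (simp add: B_def)
  have Bn: "mat_adjoint B * B = B * mat_adjoint B"
    unfolding B_def by (rule normal_conj_unitary[OF A V])
  have B0: "B $$ (i,0) = (if i = 0 then e else 0)" if "i < Suc n" for i
  proof -
    have "B $$ (i,0) = (\<Sum>l<Suc n. mat_adjoint V $$ (i,l) * (A * V) $$ (l,0))"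
      unfolding B_def by (rule mat_mult_index[of _ "Suc n" "Suc n" _ "Suc n"]) (use that A in auto)
    also have "\<dots> = e * (\<Sum>l<Suc n. mat_adjoint V $$ (i,l) * V $$ (l,0))"
      unfolding sum_distrib_left by (rule sum.cong) (auto simp: ev)
    also have "(\<Sum>l<Suc n. mat_adjoint V $$ (i,l) * V $$ (l,0)) = (mat_adjoint V * V) $$ (i,0)"
      by (rule mat_mult_index[of _ "Suc n" "Suc n" _ "Suc n", symmetric]) (use that in auto)
    finally show ?thesis using that by simp
  qed
  \<comment> \<open>The two corner entries are the squared lengths of the first column and of the
    first row. Normality equates them, and the column contributes only \<open>e\<close>, so the
    other squares in the row sum to zero.\<close>
  have "(mat_adjoint B * B) $$ (0,0) = complex_of_real ((cmod e)\<^sup>2)"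
    using B by (subst mat_mult_index[of _ "Suc n" "Suc n" _ "Suc n"])
      (auto simp: B0 complex_norm_square mult.commute sum.lessThan_Suc_shift simp del: sum.lessThan_Suc of_real_power)
  moreover have "(B * mat_adjoint B) $$ (0,0) = complex_of_real ((cmod e)\<^sup>2 + (\<Sum>l<n. (cmod (B $$ (0, Suc l)))\<^sup>2))"
    using B by (subst mat_mult_index[of _ "Suc n" "Suc n" _ "Suc n"])
      (auto simp: B0 complex_norm_square mult.commute sum.lessThan_Suc_shift simp del: sum.lessThan_Suc of_real_power)
  ultimately have "(\<Sum>l<n. (cmod (B $$ (0, Suc l)))\<^sup>2) = 0"
    using Bn by (metis add_cancel_left_right of_real_eq_iff)
  then have row0: "B $$ (0, Suc l) = 0" if "l < n" for l
    using that by (subst (asm) sum_nonneg_eq_0_iff) auto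
  define A3 where "A3 = Matrix.mat n n (\<lambda>(i,j). B $$ (Suc i, Suc j))"
  have A3: "A3 \<in> carrier_mat n n" by (simp add: A3_def)
  have BA3: "B = bordered e A3"
    by (rule eq_matI, insert B) (auto simp: bordered_def A3_def B0 row0 split: nat.splits)
  have "mat_adjoint A3 * A3 = A3 * mat_adjoint A3"
    by (rule bordered_inject[where n = n]) (use Bn A3 in \<open>auto simp: BA3 bordered_adjoint bordered_mult[of _ n n _ n]\<close>)
  from Suc.IH[OF A3 this] obtain V3 l where V3: "unitary_mat n V3"
    and A3l: "A3 = V3 * mat_diag n l * mat_adjoint V3" by blast
  note V3D = unitary_matD[OF V3]
  define X where "X = bordered 1 V3"
  have X: "unitary_mat (Suc n) X"
    using V3D by (auto simp: unitary_mat_def X_def bordered_adjoint bordered_mult[of _ n n _ n] bordered_one)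
  note XD [simp] = unitary_matD(1)[OF X]
  have BX: "B = X * mat_diag (Suc n) (case_nat e l) * mat_adjoint X"
    unfolding BA3 A3l X_def bordered_adjoint bordered_diag[symmetric] using V3D
    by (simp add: bordered_mult[of _ n n _ n])
  have "A = V * B * mat_adjoint V"
    using A by (simp add: B_def mult_left_cancel_mat[of _ _ "Suc n"] assoc_mult_mat[of _ "Suc n" "Suc n" _ "Suc n" _ "Suc n"])
  also have "\<dots> = (V * X) * mat_diag (Suc n) (case_nat e l) * mat_adjoint (V * X)"
    by (simp add: BX mat_adjoint_mult[of _ "Suc n" "Suc n" _ "Suc n"] assoc_mult_mat[of _ "Suc n" "Suc n" _ "Suc n" _ "Suc n"])
  finally show ?case using unitary_mat_mult[OF V X] by blast
qed

subsection \<open>Trace norm\<close>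

lemma mat_diag_mult_one [simp]: "mat_diag n l * 1\<^sub>m n = mat_diag n l" for l :: "nat \<Rightarrow> complex"
  by (rule right_mult_one_mat[OF mat_diag_dim])

lemma conj_diag_mult:
  assumes "unitary_mat n V"
  shows "(V * mat_diag n k * mat_adjoint V) * (V * mat_diag n l * mat_adjoint V)
    = V * mat_diag n (\<lambda>i. k i * l i) * mat_adjoint V"
proof -
  note VD [simp] = unitary_matD[OF assms]
  have [simp]: "mat_diag n k * (mat_diag n l * C) = mat_diag n (\<lambda>i. k i * l i) * C" if "C \<in> carrier_mat n n" for C
    using that by (simp flip: assoc_mult_mat[of _ n n _ n _ n])
  show ?thesis
    by (simp add: assoc_mult_mat[of _ n n _ n _ n] mult_left_cancel_mat[of _ _ n])
qed

lemma conj_diag_adjoint: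
  assumes "unitary_mat n V"
  shows "mat_adjoint (V * mat_diag n l * mat_adjoint V) = V * mat_diag n (\<lambda>i. cnj (l i)) * mat_adjoint V"
  using unitary_matD[OF assms]
  by (simp add: mat_adjoint_mult[of _ n n _ n] assoc_mult_mat[of _ n n _ n _ n])

lemma conj_diag_cancel:
  assumes "unitary_mat n V"
  shows "mat_adjoint V * ((V * mat_diag n l * mat_adjoint V) * V) = mat_diag n l"
  using unitary_matD[OF assms]
  by (simp add: assoc_mult_mat[of _ n n _ n _ n] mult_left_cancel_mat[of _ _ n])

lemma one_smult_mat [simp]: "(1 :: complex) \<cdot>\<^sub>m A = A"
  by (rule eq_matI) auto

lemma mtrace_mult_comm:
  assumes "A \<in> carrier_mat n m" "B \<in> carrier_mat m n"
  shows "mtrace (A * B) = mtrace (B * A)"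
proof -
  have "mtrace (A * B) = (\<Sum>i<n. \<Sum>j<m. A $$ (i,j) * B $$ (j,i))"
    unfolding mtrace_def using assms
    by (intro sum.cong) (auto simp: mat_mult_index[of _ n m _ n] simp del: index_mult_mat(1))
  also have "\<dots> = (\<Sum>j<m. \<Sum>i<n. B $$ (j,i) * A $$ (i,j))"
    by (subst sum.swap) (simp add: mult.commute)
  also have "\<dots> = mtrace (B * A)"
    unfolding mtrace_def using assms
    by (intro sum.cong) (auto simp: mat_mult_index[of _ m n _ m] simp del: index_mult_mat(1))
  finally show ?thesis .
qed

lemma mtrace_conj_diag:
  assumes "unitary_mat n V"
  shows "mtrace (V * mat_diag n l * mat_adjoint V) = (\<Sum>i<n. l i)"
proof -
  note VD = unitary_matD[OF assms]
  have "mtrace (V * mat_diag n l * mat_adjoint V) = mtrace (mat_adjoint V * (V * mat_diag n l))"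
    using VD by (intro mtrace_mult_comm[of _ n n]) auto
  also have "mat_adjoint V * (V * mat_diag n l) = mat_diag n l"
    using VD by (simp add: mult_left_cancel_mat[of _ _ n])
  also have "mtrace (mat_diag n l) = (\<Sum>i<n. l i)" by (simp add: mtrace_def mat_diag_def)
  finally show ?thesis .
qed

lemma cscalar_prod_self:
  fixes v :: "complex Matrix.vec"
  assumes "v \<in> carrier_vec n"
  shows "v \<bullet>c v = complex_of_real (\<Sum>i<n. (cmod (v $ i))\<^sup>2)"
  using assms by (auto simp: scalar_prod_def atLeast0LessThan complex_norm_square simp del: of_real_power intro!: sum.cong)

lemma mult_mat_vec_cscalar_prod:
  fixes A :: "complex mat"
  assumes "A \<in> carrier_mat n m" "v \<in> carrier_vec m" "w \<in> carrier_vec n"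
  shows "(A *\<^sub>v v) \<bullet>c w = v \<bullet>c (mat_adjoint A *\<^sub>v w)"
proof -
  have "(A *\<^sub>v v) \<bullet>c w = (\<Sum>i<n. \<Sum>j<m. A $$ (i,j) * v $ j * cnj (w $ i))"
    using assms by (auto simp: scalar_prod_def atLeast0LessThan sum_distrib_right intro!: sum.cong)
  also have "\<dots> = (\<Sum>j<m. \<Sum>i<n. A $$ (i,j) * v $ j * cnj (w $ i))"
    by (rule sum.swap)
  also have "\<dots> = v \<bullet>c (mat_adjoint A *\<^sub>v w)"
    using assms by (auto simp: scalar_prod_def atLeast0LessThan sum_distrib_left mult_ac intro!: sum.cong)
  finally show ?thesis .
qed

text \<open>The quadratic form at \<open>v\<close> is \<open>c\<close> times the squared length of
  \<open>A *\<^sub>v v\<close>. The factor \<open>c\<close> serves the modulus of a difference of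
  projections, which is a multiple of its square.\<close>

lemma psd_adjoint_mult_self:
  assumes A: "A \<in> carrier_mat n n" and "c \<ge> 0"
  shows "psd n (complex_of_real c \<cdot>\<^sub>m (mat_adjoint A * A))"
proof -
  have "0 \<le> Re (((complex_of_real c \<cdot>\<^sub>m (mat_adjoint A * A)) *\<^sub>v v) \<bullet>c v)" if v: "v \<in> carrier_vec n" for v
  proof -
    have Av: "A *\<^sub>v v \<in> carrier_vec n" using A v by simp
    have "(complex_of_real c \<cdot>\<^sub>m (mat_adjoint A * A)) *\<^sub>v v = complex_of_real c \<cdot>\<^sub>v (mat_adjoint A *\<^sub>v (A *\<^sub>v v))"
      using A v by (subst assoc_mult_mat_vec[of _ n n _ n, symmetric])
        (auto simp: scalar_prod_def sum_distrib_left mult.assoc intro!: eq_vecI sum.cong)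
    then have "((complex_of_real c \<cdot>\<^sub>m (mat_adjoint A * A)) *\<^sub>v v) \<bullet>c v
        = complex_of_real c * ((mat_adjoint A *\<^sub>v (A *\<^sub>v v)) \<bullet>c v)"
      using A v by simp
    also have "(mat_adjoint A *\<^sub>v (A *\<^sub>v v)) \<bullet>c v = (A *\<^sub>v v) \<bullet>c (A *\<^sub>v v)"
      using mult_mat_vec_cscalar_prod[of "mat_adjoint A" n n "A *\<^sub>v v" v] A v by simp
    finally show ?thesis using \<open>c \<ge> 0\<close> by (simp add: cscalar_prod_self[OF Av] sum_nonneg)
  qed
  moreover have "mat_adjoint (complex_of_real c \<cdot>\<^sub>m (mat_adjoint A * A)) = complex_of_real c \<cdot>\<^sub>m (mat_adjoint A * A)"
    using A by (simp add: mat_adjoint_smult mat_adjoint_mult[of _ n n _ n])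
  ultimately show ?thesis using A by (auto simp: psd_def)
qed

lemma hermitian_diagonalization:
  assumes A: "A \<in> carrier_mat n n" "mat_adjoint A = A"
  obtains V l where "unitary_mat n V" "A = V * mat_diag n (\<lambda>i. complex_of_real (l i)) * mat_adjoint V"
proof -
  obtain V l where V: "unitary_mat n V" and Al: "A = V * mat_diag n l * mat_adjoint V"
    using normal_mat_unitarily_diagonalizable[OF A(1)] A(2) by auto
  \<comment> \<open>Conjugating back by \<open>V\<close> turns self-adjointness of \<open>A\<close>
    into equality of the diagonal with its complex conjugate.\<close>
  have "mat_diag n (\<lambda>i. cnj (l i)) = mat_adjoint V * (mat_adjoint A * V)"
    unfolding Al conj_diag_adjoint[OF V] conj_diag_cancel[OF V] ..
  also have "\<dots> = mat_diag n l" unfolding A(2) by (simp add: Al conj_diag_cancel[OF V])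
  finally have eq: "mat_diag n (\<lambda>i. cnj (l i)) = mat_diag n l" .
  have "l i = complex_of_real (Re (l i))" if "i < n" for i
    using arg_cong[OF eq, of "\<lambda>M. M $$ (i,i)"] that by (simp add: mat_diag_def complex_eq_iff)
  then have "mat_diag n l = mat_diag n (\<lambda>i. complex_of_real (Re (l i)))"
    unfolding mat_diag_def by (intro eq_matI) auto
  then show ?thesis using that V Al by metis
qed

text \<open>Each column of \<open>V\<close> is a unit eigenvector, so the quadratic form evaluated
  there is the eigenvalue itself.\<close>

lemma psd_diagonalization:
  assumes "psd n A"
  obtains V l where "unitary_mat n V" "A = V * mat_diag n (\<lambda>i. complex_of_real (l i)) * mat_adjoint V"
    "\<And>i. i < n \<Longrightarrow> 0 \<le> l i"
proof -
  have A: "A \<in> carrier_mat n n" "mat_adjoint A = A"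
    and pos: "\<And>v. v \<in> carrier_vec n \<Longrightarrow> 0 \<le> Re ((A *\<^sub>v v) \<bullet>c v)" using assms by (auto simp: psd_def)
  obtain V l where V: "unitary_mat n V" and Al: "A = V * mat_diag n (\<lambda>i. complex_of_real (l i)) * mat_adjoint V"
    using hermitian_diagonalization[OF A] by blast
  note VD = unitary_matD[OF V]
  have "0 \<le> l i" if i: "i < n" for i
  proof -
    have c: "col V i \<in> carrier_vec n" using VD(1) i by auto
    have AV: "A * V = V * mat_diag n (\<lambda>i. complex_of_real (l i))"
      using VD by (simp add: Al assoc_mult_mat[of _ n n _ n _ n])
    have "A *\<^sub>v col V i = col (A * V) i" using col_mult2[OF A(1) VD(1) i] by simp
    also have "\<dots> = complex_of_real (l i) \<cdot>\<^sub>v col V i"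
      unfolding AV mat_diag_mult_right[OF VD(1)] using VD(1) i by (intro eq_vecI) auto
    finally have "(A *\<^sub>v col V i) \<bullet>c col V i = complex_of_real (l i) * (col V i \<bullet>c col V i)"
      using c by simp
    also have "col V i \<bullet>c col V i = 1"
      using cscalar_prod_self[OF c] unitary_mat_col[OF V i] i VD(1) by simp
    finally show ?thesis using pos[OF c] by simp
  qed
  then show ?thesis using that V Al by blast
qed

lemma psd_conj_diag:
  assumes V: "unitary_mat n V" and l: "\<And>i. i < n \<Longrightarrow> 0 \<le> l i"
  shows "psd n (V * mat_diag n (\<lambda>i. complex_of_real (l i)) * mat_adjoint V)"
proof -
  let ?R = "V * mat_diag n (\<lambda>i. complex_of_real (sqrt (l i))) * mat_adjoint V"
  have R: "?R \<in> carrier_mat n n" using unitary_matD(1)[OF V] by auto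
  have "mat_diag n (\<lambda>i. complex_of_real (sqrt (l i)) * complex_of_real (sqrt (l i))) = mat_diag n (\<lambda>i. complex_of_real (l i))"
    using l by (auto simp: mat_diag_def simp flip: of_real_mult intro!: eq_matI)
  then have "mat_adjoint ?R * ?R = V * mat_diag n (\<lambda>i. complex_of_real (l i)) * mat_adjoint V"
    by (simp add: conj_diag_adjoint[OF V] conj_diag_mult[OF V])
  then show ?thesis using psd_adjoint_mult_self[OF R, of 1] by simp
qed

text \<open>In eigenbases of \<open>B\<close> and \<open>C\<close>, the transition matrix \<open>M\<close> satisfies
  \<open>b\<^sub>i\<^sup>2 M\<^sub>i\<^sub>j = M\<^sub>i\<^sub>j c\<^sub>j\<^sup>2\<close>, hence \<open>b\<^sub>i M\<^sub>i\<^sub>j = M\<^sub>i\<^sub>j c\<^sub>j\<close>.\<close>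
lemma psd_square_root_unique:
  assumes "psd n B" "psd n C" and eq: "B * B = C * C"
  shows "B = C"
proof -
  obtain V b where V: "unitary_mat n V" and B: "B = V * mat_diag n (\<lambda>i. complex_of_real (b i)) * mat_adjoint V"
    and b: "\<And>i. i < n \<Longrightarrow> 0 \<le> b i" using psd_diagonalization[OF assms(1)] by blast
  obtain X c where X: "unitary_mat n X" and C: "C = X * mat_diag n (\<lambda>i. complex_of_real (c i)) * mat_adjoint X"
    and c: "\<And>i. i < n \<Longrightarrow> 0 \<le> c i" using psd_diagonalization[OF assms(2)] by blast
  note VD [simp] = unitary_matD[OF V] and XD [simp] = unitary_matD[OF X]
  define M where "M = mat_adjoint V * X"
  have M: "M \<in> carrier_mat n n" by (simp add: M_def)
  have intertwine: "mat_adjoint V * ((V * mat_diag n k * mat_adjoint V) * X) = mat_diag n k * M"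
    "mat_adjoint V * ((X * mat_diag n k * mat_adjoint X) * X) = M * mat_diag n k" for k
    by (simp_all add: M_def assoc_mult_mat[of _ n n _ n _ n] mult_left_cancel_mat[of _ _ n])
  have "mat_diag n (\<lambda>i. complex_of_real (b i) * complex_of_real (b i)) * M = M * mat_diag n (\<lambda>i. complex_of_real (c i) * complex_of_real (c i))"
    using eq unfolding B C conj_diag_mult[OF V] conj_diag_mult[OF X] intertwine[symmetric] by simp
  then have sq: "(complex_of_real (b i) * complex_of_real (b i)) * M $$ (i,j)
      = M $$ (i,j) * (complex_of_real (c j) * complex_of_real (c j))" if "i < n" "j < n" for i j
    unfolding mat_diag_mult_left[OF M] mat_diag_mult_right[OF M]
    using that by (auto dest!: arg_cong[where f = "\<lambda>A. A $$ (i,j)"])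
  have "complex_of_real (b i) * M $$ (i,j) = M $$ (i,j) * complex_of_real (c j)" if ij: "i < n" "j < n" for i j
  proof (cases "M $$ (i,j) = 0")
    case False
    then have "(b i)\<^sup>2 = (c j)\<^sup>2"
      using sq[OF ij] by (simp add: power2_eq_square mult.commute flip: of_real_mult)
    then show ?thesis using b[OF ij(1)] c[OF ij(2)] by (simp add: power2_eq_iff_nonneg mult.commute)
  qed simp
  then have eqM: "mat_diag n (\<lambda>i. complex_of_real (b i)) * M = M * mat_diag n (\<lambda>i. complex_of_real (c i))"
    unfolding mat_diag_mult_left[OF M] mat_diag_mult_right[OF M] by (intro eq_matI) auto
  have "B = V * (mat_diag n (\<lambda>i. complex_of_real (b i)) * M) * mat_adjoint X"
    by (simp add: right_mult_one_mat[of _ n n] B M_def assoc_mult_mat[of _ n n _ n _ n] mult_left_cancel_mat[of _ _ n])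
  also have "\<dots> = C"
    unfolding eqM by (simp add: C M_def assoc_mult_mat[of _ n n _ n _ n] mult_left_cancel_mat[of _ _ n])
  finally show ?thesis .
qed

text \<open>Uniqueness of the positive square root resolves the definite description: any positive
  root that can be exhibited computes the trace norm.\<close>

lemma trace_norm_eqI:
  assumes "A \<in> carrier_mat n n" "psd n B" "B * B = mat_adjoint A * A"
  shows "trace_norm A = Re (mtrace B)"
proof -
  have "(THE B. psd (dim_col A) B \<and> B * B = mat_adjoint A * A) = B"
    using assms psd_square_root_unique by (intro the_equality) auto
  then show ?thesis by (simp add: trace_norm_def)
qed

lemma trace_norm_conj_diag:
  assumes V: "unitary_mat n V"
  shows "trace_norm (V * mat_diag n l * mat_adjoint V) = (\<Sum>i<n. cmod (l i))"
proof -
  let ?B = "V * mat_diag n (\<lambda>i. complex_of_real (cmod (l i))) * mat_adjoint V"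
  have "mat_diag n (\<lambda>i. complex_of_real (cmod (l i)) * complex_of_real (cmod (l i))) = mat_diag n (\<lambda>i. cnj (l i) * l i)"
    by (intro arg_cong[where f = "mat_diag n"] ext) (metis complex_norm_square mult.commute power2_eq_square of_real_power)
  then have "trace_norm (V * mat_diag n l * mat_adjoint V) = Re (mtrace ?B)"
    using unitary_matD(1)[OF V] psd_conj_diag[OF V]
    by (intro trace_norm_eqI[of _ n]) (auto simp: conj_diag_mult[OF V] conj_diag_adjoint[OF V])
  then show ?thesis by (simp add: mtrace_conj_diag[OF V])
qed

lemma trace_norm_hermitian_nonneg:
  assumes "A \<in> carrier_mat n n" "mat_adjoint A = A"
  shows "trace_norm A \<ge> 0"
proof -
  obtain V l where "unitary_mat n V" "A = V * mat_diag n (\<lambda>i. complex_of_real (l i)) * mat_adjoint V"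
    using hermitian_diagonalization[OF assms] .
  then show ?thesis using trace_norm_conj_diag[of n V] by (simp add: sum_nonneg)
qed

subsection \<open>Distance of a state to its unitary conjugate\<close>

text \<open>The left side is the l1 distance of the outcome distributions of two pure states. A
  difference of squares is bounded by \<open>cmod (x - y) * cmod (x + y)\<close>, and Cauchy-Schwarz
  separates the two factors.\<close>

lemma sum_abs_cmod_square_diff_le:
  fixes a b :: "nat \<Rightarrow> complex"
  assumes a: "(\<Sum>k<n. (cmod (a k))\<^sup>2) = 1" and b: "(\<Sum>k<n. (cmod (b k))\<^sup>2) = 1"
  shows "(\<Sum>k<n. \<bar>(cmod (a k))\<^sup>2 - (cmod (b k))\<^sup>2\<bar>) \<le> 2 * sqrt (1 - (cmod (\<Sum>k<n. cnj (a k) * b k))\<^sup>2)"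
proof -
  define z where "z = (\<Sum>k<n. cnj (a k) * b k)"
  \<comment> \<open>The left side ignores a global phase of \<open>b\<close>. The phase that makes
    the inner product equal to \<open>cmod z\<close> gives squared lengths
    \<open>2 - 2 * cmod z\<close> and \<open>2 + 2 * cmod z\<close>, with product
    \<open>4 * (1 - (cmod z)\<^sup>2)\<close>.\<close>
  obtain u where u: "cmod u = 1" "u * z = complex_of_real (cmod z)"
  proof (cases "z = 0")
    case False
    then have "cnj (sgn z) * z = complex_of_real (cmod z)"
      by (simp add: sgn_eq complex_norm_square[symmetric] mult.commute power2_eq_square)
    then show ?thesis using that[of "cnj (sgn z)"] False by (simp add: norm_sgn)
  qed (use that[of 1] in auto)
  define b' where "b' k = u * b k" for k
  have b': "(\<Sum>k<n. (cmod (b' k))\<^sup>2) = 1" using b u by (simp add: b'_def norm_mult)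
  have ip: "(\<Sum>k<n. Re (cnj (a k) * b' k)) = cmod z"
  proof -
    have "(\<Sum>k<n. cnj (a k) * b' k) = u * z"
      by (simp add: z_def b'_def sum_distrib_left mult_ac)
    then show ?thesis using u by (metis Re_complex_of_real Re_sum)
  qed
  have sq: "(cmod (x + y))\<^sup>2 = (cmod x)\<^sup>2 + (cmod y)\<^sup>2 + 2 * Re (cnj x * y)"
    "(cmod (x - y))\<^sup>2 = (cmod x)\<^sup>2 + (cmod y)\<^sup>2 - 2 * Re (cnj x * y)" for x y
    by (simp_all add: cmod_power2) (simp_all add: power2_eq_square algebra_simps)
  have le: "\<bar>(cmod x)\<^sup>2 - (cmod y)\<^sup>2\<bar> \<le> \<bar>cmod (x - y)\<bar> * \<bar>cmod (x + y)\<bar>" for x y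
  proof -
    have "(cmod x)\<^sup>2 - (cmod y)\<^sup>2 = Re ((x - y) * cnj (x + y))"
      by (simp add: cmod_power2) (simp add: power2_eq_square algebra_simps)
    also have "\<bar>\<dots>\<bar> \<le> cmod ((x - y) * cnj (x + y))" by (rule abs_Re_le_cmod)
    finally show ?thesis by (simp only: norm_mult complex_mod_cnj abs_norm_cancel)
  qed
  have "(\<Sum>k<n. \<bar>(cmod (a k))\<^sup>2 - (cmod (b k))\<^sup>2\<bar>) = (\<Sum>k<n. \<bar>(cmod (a k))\<^sup>2 - (cmod (b' k))\<^sup>2\<bar>)"
    by (simp add: b'_def norm_mult u)
  also have "\<dots> \<le> (\<Sum>k<n. \<bar>cmod (a k - b' k)\<bar> * \<bar>cmod (a k + b' k)\<bar>)"
    by (intro sum_mono le)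
  also have "\<dots> \<le> L2_set (\<lambda>k. cmod (a k - b' k)) {..<n} * L2_set (\<lambda>k. cmod (a k + b' k)) {..<n}"
    by (rule L2_set_mult_ineq)
  also have "\<dots> = sqrt (2 - 2 * cmod z) * sqrt (2 + 2 * cmod z)"
    by (simp add: L2_set_def sq sum.distrib sum_subtractf a b' flip: sum_distrib_left ip)
  also have "\<dots> = sqrt (4 * (1 - (cmod z)\<^sup>2))"
    by (simp add: power2_eq_square algebra_simps flip: real_sqrt_mult)
  also have "\<dots> = 2 * sqrt (1 - (cmod z)\<^sup>2)" by (simp only: real_sqrt_mult) simp
  finally show ?thesis by (simp add: z_def)
qed

lemma smult_diff_hermitian:
  fixes A W :: "complex mat" and t :: real
  assumes A: "A \<in> carrier_mat n n" "mat_adjoint A = A" and W: "W \<in> carrier_mat n n"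
  defines "D \<equiv> complex_of_real t \<cdot>\<^sub>m (A - W * A * mat_adjoint W)"
  shows "D \<in> carrier_mat n n" "mat_adjoint D = D"
  using A W by (auto simp: D_def mat_adjoint_smult mat_adjoint_minus[of _ n n] minus_carrier_mat
      mat_adjoint_mult[of _ n n _ n] assoc_mult_mat[of _ n n _ n _ n])

lemma conj_diag_index:
  fixes F :: "complex mat"
  assumes "F \<in> carrier_mat n n" "k < n"
  shows "(F * mat_diag n (\<lambda>i. complex_of_real (p i)) * mat_adjoint F) $$ (k,k)
    = complex_of_real (\<Sum>m<n. p m * (cmod (F $$ (k,m)))\<^sup>2)"
  using assms
  by (subst mat_mult_index[of _ n n _ n])
     (auto simp: mat_diag_mult_right[of _ n] complex_norm_square mult_ac simp del: of_real_power intro!: sum.cong)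

text \<open>Spectrally decomposing \<open>\<sigma>\<close> reduces the bound to pure states, i.e. to columns of \<open>R\<close>;
  the absolute eigenvalues of the difference are estimated in its own eigenbasis.\<close>
lemma trace_norm_unitary_conj_diff_le:
  assumes W: "unitary_mat n W" and \<sigma>: "density n \<sigma>" and "0 \<le> \<nu>"
    and \<nu>: "\<And>R m. unitary_mat n R \<Longrightarrow> m < n \<Longrightarrow> \<nu> \<le> cmod ((mat_adjoint R * (W * R)) $$ (m,m))"
  shows "trace_norm (complex_of_real t \<cdot>\<^sub>m (\<sigma> - W * \<sigma> * mat_adjoint W)) \<le> 2 * \<bar>t\<bar> * sqrt (1 - \<nu>\<^sup>2)"
proof -
  have psd: "psd n \<sigma>" and tr: "mtrace \<sigma> = 1" using \<sigma> by (auto simp: density_def)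
  obtain R p where R: "unitary_mat n R" and \<sigma>R: "\<sigma> = R * mat_diag n (\<lambda>i. complex_of_real (p i)) * mat_adjoint R"
    and p: "\<And>i. i < n \<Longrightarrow> 0 \<le> p i" using psd_diagonalization[OF psd] by blast
  have sum_p: "(\<Sum>i<n. p i) = 1"
    using tr unfolding \<sigma>R mtrace_conj_diag[OF R] by (metis of_real_eq_1_iff of_real_sum)
  define D where "D = complex_of_real t \<cdot>\<^sub>m (\<sigma> - W * \<sigma> * mat_adjoint W)"
  note WD [simp] = unitary_matD[OF W] and RD [simp] = unitary_matD[OF R]
  have \<sigma>c: "\<sigma> \<in> carrier_mat n n" "mat_adjoint \<sigma> = \<sigma>" using psd by (auto simp: psd_def)
  have D: "D \<in> carrier_mat n n" "mat_adjoint D = D"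
    using smult_diff_hermitian[OF \<sigma>c WD(1)] by (simp_all add: D_def)
  obtain V l where V: "unitary_mat n V" and DV: "D = V * mat_diag n (\<lambda>i. complex_of_real (l i)) * mat_adjoint V"
    using hermitian_diagonalization[OF D] by blast
  note VD [simp] = unitary_matD[OF V]
  \<comment> \<open>Coordinates in the eigenbasis of \<open>D\<close>: the columns of
    \<open>F\<close> are the eigenvectors of \<open>\<sigma>\<close>, those of \<open>G\<close>
    their images under \<open>W\<close>.\<close>
  define F G where "F = mat_adjoint V * R" and "G = mat_adjoint V * (W * R)"
  have F: "unitary_mat n F" and G: "unitary_mat n G"
    unfolding F_def G_def by (intro unitary_mat_mult unitary_mat_adjoint V W R)+
  note FD [simp] = unitary_matD[OF F] and GD [simp] = unitary_matD[OF G]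
  let ?P = "mat_diag n (\<lambda>i. complex_of_real (p i))"
  define \<delta> where "\<delta> k m = (cmod (F $$ (k,m)))\<^sup>2 - (cmod (G $$ (k,m)))\<^sup>2" for k m
  have l: "l k = t * (\<Sum>m<n. p m * \<delta> k m)" if k: "k < n" for k
  proof -
    have "mat_diag n (\<lambda>i. complex_of_real (l i)) = mat_adjoint V * (D * V)"
      unfolding DV conj_diag_cancel[OF V] ..
    also have "\<dots> = complex_of_real t \<cdot>\<^sub>m (F * ?P * mat_adjoint F - G * ?P * mat_adjoint G)"
    proof -
      have "mat_adjoint V * (D * V) = complex_of_real t \<cdot>\<^sub>m (mat_adjoint V * ((\<sigma> - W * \<sigma> * mat_adjoint W) * V))"
        unfolding D_def using \<sigma>c
        by (simp add: mult_smult_distrib[of _ n n _ n] mult_smult_assoc_mat[of _ n n _ n] minus_carrier_mat)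
      also have "mat_adjoint V * ((\<sigma> - W * \<sigma> * mat_adjoint W) * V)
          = mat_adjoint V * (\<sigma> * V) - mat_adjoint V * ((W * \<sigma> * mat_adjoint W) * V)"
        using \<sigma>c by (simp add: minus_mult_distrib_mat[of _ n n _ _ n] mult_minus_distrib_mat[of _ n n _ n])
      also have "mat_adjoint V * (\<sigma> * V) = F * ?P * mat_adjoint F"
        by (simp add: \<sigma>R F_def assoc_mult_mat[of _ n n _ n _ n] mat_adjoint_mult[of _ n n _ n])
      also have "mat_adjoint V * ((W * \<sigma> * mat_adjoint W) * V) = G * ?P * mat_adjoint G"
        by (simp add: \<sigma>R G_def assoc_mult_mat[of _ n n _ n _ n] mat_adjoint_mult[of _ n n _ n])
      finally show ?thesis .
    qed
    finally have "mat_diag n (\<lambda>i. complex_of_real (l i)) $$ (k,k)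
        = (complex_of_real t \<cdot>\<^sub>m (F * ?P * mat_adjoint F - G * ?P * mat_adjoint G)) $$ (k,k)" by simp
    also have "\<dots> = complex_of_real t * ((F * ?P * mat_adjoint F) $$ (k,k) - (G * ?P * mat_adjoint G) $$ (k,k))"
      using k carrier_matD[OF FD(1)] carrier_matD[OF GD(1)] by (simp del: index_mult_mat(1))
    also have "\<dots> = complex_of_real (t * (\<Sum>m<n. p m * \<delta> k m))"
      unfolding conj_diag_index[OF FD(1) k] conj_diag_index[OF GD(1) k]
      by (simp add: \<delta>_def right_diff_distrib sum_subtractf)
    finally have "complex_of_real (l k) = complex_of_real (t * (\<Sum>m<n. p m * \<delta> k m))"
      using k by (simp add: mat_diag_def)
    then show ?thesis by (simp only: of_real_eq_iff)
  qed
  have col: "(\<Sum>k<n. \<bar>\<delta> k m\<bar>) \<le> 2 * sqrt (1 - \<nu>\<^sup>2)" if m: "m < n" for m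
  proof -
    \<comment> \<open>The overlap of the two columns does not depend on the eigenbasis
      \<open>V\<close>, so the hypothesis on \<open>\<nu>\<close> applies to it.\<close>
    have "(\<Sum>k<n. cnj (F $$ (k,m)) * G $$ (k,m)) = (mat_adjoint F * G) $$ (m,m)"
      using m carrier_matD[OF FD(1)] by (subst mat_mult_index[OF mat_adjoint_carrier[OF FD(1)] GD(1)]) auto
    also have "mat_adjoint F * G = mat_adjoint R * (W * R)"
      by (simp add: F_def G_def mat_adjoint_mult[of _ n n _ n] assoc_mult_mat[of _ n n _ n _ n] mult_left_cancel_mat[of _ _ n])
    finally have "\<nu> \<le> cmod (\<Sum>k<n. cnj (F $$ (k,m)) * G $$ (k,m))" using \<nu>[OF R m] by simp
    then have "\<nu>\<^sup>2 \<le> (cmod (\<Sum>k<n. cnj (F $$ (k,m)) * G $$ (k,m)))\<^sup>2"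
      using \<open>0 \<le> \<nu>\<close> by (rule power_mono)
    then show ?thesis
      using sum_abs_cmod_square_diff_le[OF unitary_mat_col[OF F m] unitary_mat_col[OF G m]]
      by (fastforce simp: \<delta>_def intro: order_trans)
  qed
  have "trace_norm D = (\<Sum>k<n. \<bar>l k\<bar>)"
    unfolding DV trace_norm_conj_diag[OF V] by simp
  also have "\<dots> \<le> (\<Sum>k<n. \<bar>t\<bar> * (\<Sum>m<n. p m * \<bar>\<delta> k m\<bar>))"
  proof (rule sum_mono)
    fix k assume "k \<in> {..<n}"
    then have "\<bar>l k\<bar> = \<bar>t\<bar> * \<bar>\<Sum>m<n. p m * \<delta> k m\<bar>" by (simp add: l abs_mult)
    also have "\<bar>\<Sum>m<n. p m * \<delta> k m\<bar> \<le> (\<Sum>m<n. \<bar>p m * \<delta> k m\<bar>)" by (rule sum_abs)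
    also have "\<dots> = (\<Sum>m<n. p m * \<bar>\<delta> k m\<bar>)" by (intro sum.cong) (auto simp: abs_mult p)
    finally show "\<bar>l k\<bar> \<le> \<bar>t\<bar> * (\<Sum>m<n. p m * \<bar>\<delta> k m\<bar>)" by (simp add: mult_left_mono)
  qed
  \<comment> \<open>Exchanging the sums isolates each eigenvector of \<open>\<sigma>\<close>; the
    column bound is then averaged with the weights \<open>p\<close>, which sum to 1.\<close>
  also have "\<dots> = \<bar>t\<bar> * (\<Sum>m<n. p m * (\<Sum>k<n. \<bar>\<delta> k m\<bar>))"
    unfolding sum_distrib_left by (rule sum.swap)
  also have "\<dots> \<le> \<bar>t\<bar> * (\<Sum>m<n. p m * (2 * sqrt (1 - \<nu>\<^sup>2)))"
    by (intro mult_left_mono sum_mono col p) auto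
  also have "\<dots> = 2 * \<bar>t\<bar> * sqrt (1 - \<nu>\<^sup>2)" by (simp add: sum_p flip: sum_distrib_right)
  finally show ?thesis by (simp add: D_def)
qed

section \<open>Lower bound for trace-one projections\<close>

lemma smult_smult_mat: "a \<cdot>\<^sub>m (b \<cdot>\<^sub>m A) = (a * b) \<cdot>\<^sub>m (A :: complex mat)"
  by (rule eq_matI) auto

lemma mtrace_smult: "A \<in> carrier_mat n n \<Longrightarrow> mtrace (c \<cdot>\<^sub>m A) = c * mtrace A"
  by (simp add: mtrace_def sum_distrib_left)

lemma mtrace_minus: "A \<in> carrier_mat n n \<Longrightarrow> B \<in> carrier_mat n n \<Longrightarrow> mtrace (A - B) = mtrace A - mtrace B"
  by (simp add: mtrace_def sum_subtractf)

text \<open>With \<open>Q = U P U\<^sup>\<dagger>\<close> and \<open>s\<^sup>2 = 1 - \<bar>a\<bar>\<^sup>2\<close> one has \<open>(P - Q)\<^sup>3 = s\<^sup>2 (P - Q)\<close>,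
  so the modulus of \<open>P - Q\<close> is \<open>(P - Q)\<^sup>2 / s\<close>.\<close>
lemma trace_norm_projection_unitary_conj_ge:
  assumes P: "P \<in> carrier_mat n n" "mat_adjoint P = P" "P * P = P" "mtrace P = 1"
    and U: "unitary_mat n U" and a: "P * (U * P) = a \<cdot>\<^sub>m P"
  shows "trace_norm (complex_of_real t \<cdot>\<^sub>m (P - U * P * mat_adjoint U)) \<ge> 2 * \<bar>t\<bar> * sqrt (1 - (cmod a)\<^sup>2)"
proof -
  note UD [simp] = unitary_matD[OF U]
  define Q where "Q = U * P * mat_adjoint U"
  have Qc: "Q \<in> carrier_mat n n" using P by (simp add: Q_def)
  define c where "c = (cmod a)\<^sup>2"
  have cc: "a * cnj a = complex_of_real c" "cnj a * a = complex_of_real c"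
    by (simp_all add: c_def complex_norm_square mult.commute del: of_real_power)
  note assoc = assoc_mult_mat[of _ n n _ n _ n]
  note sm = mult_smult_distrib[of _ n n _ n] mult_smult_assoc_mat[of _ n n _ n] smult_smult_mat
  have a': "P * (mat_adjoint U * P) = cnj a \<cdot>\<^sub>m P"
    using arg_cong[OF a, of mat_adjoint] P
    by (simp add: mat_adjoint_mult[of _ n n _ n] mat_adjoint_smult assoc)
  \<comment> \<open>In right-nested products each identity is also needed with a trailing factor
    \<open>C\<close>.\<close>
  have aC: "P * (U * (P * C)) = a \<cdot>\<^sub>m (P * C)" "P * (mat_adjoint U * (P * C)) = cnj a \<cdot>\<^sub>m (P * C)"
    "P * (P * C) = P * C" if "C \<in> carrier_mat n n" for C
  proof -
    have "P * (U * (P * C)) = (P * (U * P)) * C" using that P by (simp add: assoc)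
    then show "P * (U * (P * C)) = a \<cdot>\<^sub>m (P * C)" using that P by (simp add: a sm)
    have "P * (mat_adjoint U * (P * C)) = (P * (mat_adjoint U * P)) * C" using that P by (simp add: assoc)
    then show "P * (mat_adjoint U * (P * C)) = cnj a \<cdot>\<^sub>m (P * C)" using that P by (simp add: a' sm)
    have "P * (P * C) = (P * P) * C" using that P(1) by (simp add: assoc)
    then show "P * (P * C) = P * C" using P by simp
  qed
  note cancel = mult_left_cancel_mat[of _ _ n]
  have QQ: "Q * Q = Q" using P by (simp add: Q_def assoc cancel aC)
  \<comment> \<open>Expanding \<open>Q\<close> exposes \<open>P * (U * P)\<close> and its adjoint
    counterpart, which contribute \<open>a\<close> and \<open>cnj a\<close>.\<close>
  have PQP: "P * (Q * P) = complex_of_real c \<cdot>\<^sub>m P" using P by (simp add: Q_def assoc cancel aC a a' sm cc)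
  have QPQ: "Q * (P * Q) = complex_of_real c \<cdot>\<^sub>m Q" using P by (simp add: Q_def assoc cancel aC a a' sm cc)
  have trQ: "mtrace Q = 1"
  proof -
    have "mtrace Q = mtrace (mat_adjoint U * (U * P))"
      unfolding Q_def using P by (intro mtrace_mult_comm[of _ n n]) auto
    then show ?thesis using P by (simp add: cancel)
  qed
  have trPQ: "mtrace (P * Q) = complex_of_real c" "mtrace (Q * P) = complex_of_real c"
  proof -
    have "mtrace (P * Q) = mtrace (P * (P * Q))" using P Qc by (simp add: aC)
    also have "\<dots> = mtrace ((P * Q) * P)" using P Qc by (intro mtrace_mult_comm[of _ n n]) auto
    also have "\<dots> = complex_of_real c" using P Qc by (simp add: assoc PQP mtrace_smult[of _ n])
    finally show *: "mtrace (P * Q) = complex_of_real c" .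
    show "mtrace (Q * P) = complex_of_real c"
      using * mtrace_mult_comm[OF P(1) Qc] by simp
  qed
  define D where "D = P - Q"
  have D: "D \<in> carrier_mat n n" using P Qc by (simp add: D_def minus_carrier_mat)
  have tD: "mat_adjoint D = D"
    using P Qc by (simp add: D_def Q_def mat_adjoint_minus[of _ n n] mat_adjoint_mult[of _ n n _ n] assoc)
  note distr = minus_mult_distrib_mat[of _ n n _ _ n] mult_minus_distrib_mat[of _ n n _ n]
  have DD: "D * D = (P - Q * P) - (P * Q - Q)"
    using P Qc by (simp add: D_def distr QQ minus_carrier_mat)
  have DDD: "D * (D * D) = complex_of_real (1 - c) \<cdot>\<^sub>m D"
  proof -
    have 1: "P * (Q * Q) = P * Q" "Q * (Q * P) = Q * P" "P * (P * Q) = P * Q" 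
      using P Qc by (simp_all add: QQ aC flip: assoc)
    have "D * (D * D) = (P - Q * P - (P * (Q * P) - Q * P)) - (P * Q - Q * (P * Q) - (P * Q - Q))"
      unfolding DD unfolding D_def using P Qc by (simp add: distr QQ 1 minus_carrier_mat)
    also have "\<dots> = complex_of_real (1 - c) \<cdot>\<^sub>m D"
      unfolding PQP QPQ D_def using P Qc by (intro eq_matI) (auto simp: algebra_simps simp del: index_mult_mat(1))
    finally show ?thesis .
  qed
  have herm: "complex_of_real t \<cdot>\<^sub>m D \<in> carrier_mat n n" "mat_adjoint (complex_of_real t \<cdot>\<^sub>m D) = complex_of_real t \<cdot>\<^sub>m D"
    using D by (simp_all add: mat_adjoint_smult tD)
  have "trace_norm (complex_of_real t \<cdot>\<^sub>m D) \<ge> 2 * \<bar>t\<bar> * sqrt (1 - c)"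
  proof (cases "c < 1")
    case True
    define s where "s = sqrt (1 - c)"
    have s: "s > 0" "1 - c = s * s" using True by (simp_all add: s_def)
    define B where "B = complex_of_real (\<bar>t\<bar> / s) \<cdot>\<^sub>m (mat_adjoint D * D)"
    have B: "psd n B" unfolding B_def by (rule psd_adjoint_mult_self) (use D s in auto)
    have "(D * D) * (D * D) = complex_of_real (1 - c) \<cdot>\<^sub>m (D * D)"
      using D by (simp add: assoc DDD sm)
    then have "B * B = complex_of_real (\<bar>t\<bar> / s * (\<bar>t\<bar> / s * (1 - c))) \<cdot>\<^sub>m (D * D)"
      using D by (simp add: B_def tD sm)
    also have "\<bar>t\<bar> / s * (\<bar>t\<bar> / s * (1 - c)) = t * t" unfolding s(2) using s(1) by (simp add: field_simps flip: abs_mult)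
    also have "complex_of_real (t * t) \<cdot>\<^sub>m (D * D)
        = mat_adjoint (complex_of_real t \<cdot>\<^sub>m D) * (complex_of_real t \<cdot>\<^sub>m D)"
      using D by (simp add: mat_adjoint_smult tD sm)
    finally have "trace_norm (complex_of_real t \<cdot>\<^sub>m D) = Re (mtrace B)"
      by (rule trace_norm_eqI[OF herm(1) B])
    \<comment> \<open>The source of the factor 2: the traces of \<open>P\<close>,
      \<open>Q * P\<close>, \<open>P * Q\<close> and \<open>Q\<close> combine to
      \<open>1 - c - c + 1\<close>.\<close>
    also have "mtrace (D * D) = complex_of_real (2 * (1 - c))"
      unfolding DD using P Qc by (simp add: mtrace_minus[of _ n] minus_carrier_mat trPQ trQ)
    then have "mtrace B = complex_of_real (\<bar>t\<bar> / s * (2 * (1 - c)))"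
      using D by (simp add: B_def tD mtrace_smult[of _ n])
    also have "\<bar>t\<bar> / s * (2 * (1 - c)) = 2 * \<bar>t\<bar> * s" unfolding s(2) using s(1) by (simp add: field_simps)
    finally show ?thesis by (simp add: s_def)
  next
    \<comment> \<open>The real \<open>sqrt\<close> is an odd function, so the bound is non-positive
      here and follows from nonnegativity of the trace norm. This spares a proof of
      \<open>cmod a \<le> 1\<close>.\<close>
    case False
    then have "2 * \<bar>t\<bar> * sqrt (1 - c) \<le> 0" by (intro mult_nonneg_nonpos) auto
    then show ?thesis using trace_norm_hermitian_nonneg[OF herm] by linarith
  qed
  then show ?thesis by (simp add: D_def Q_def c_def)
qed

text \<open>The convex hull of finitely many points is compact, so it has a point nearest to 0. For
  the eigenvalues of \<open>U\<close>, its modulus is the smallest overlap that a probe can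
  reach.\<close>

lemma convex_combination_min_cmod:
  fixes f :: "nat \<Rightarrow> complex"
  assumes "n > 0"
  obtains q where "\<And>i. i < n \<Longrightarrow> 0 \<le> q i" "(\<Sum>i<n. q i) = 1"
    "\<And>q'. (\<And>i. i < n \<Longrightarrow> 0 \<le> q' i) \<Longrightarrow> (\<Sum>i<n. q' i) = 1 \<Longrightarrow>
       cmod (\<Sum>i<n. complex_of_real (q i) * f i) \<le> cmod (\<Sum>i<n. complex_of_real (q' i) * f i)"
proof -
  \<comment> \<open>\<open>K\<close> puts weights on the indices rather than on the points, which
    accommodates repeated values of \<open>f\<close>.\<close>
  define K where "K = {\<Sum>i<n. complex_of_real (q i) * f i |q. (\<forall>i<n. 0 \<le> q i) \<and> (\<Sum>i<n. q i) = 1}"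
  have "convex K"
  proof (rule convexI)
    fix x y u v :: real and z w assume "z \<in> K" "w \<in> K" and uv: "0 \<le> u" "0 \<le> v" "u + v = 1"
    then obtain q r where q: "z = (\<Sum>i<n. complex_of_real (q i) * f i)" "\<forall>i<n. 0 \<le> q i" "(\<Sum>i<n. q i) = 1"
      and r: "w = (\<Sum>i<n. complex_of_real (r i) * f i)" "\<forall>i<n. 0 \<le> r i" "(\<Sum>i<n. r i) = 1"
      by (auto simp: K_def)
    have "u *\<^sub>R z + v *\<^sub>R w = (\<Sum>i<n. complex_of_real (u * q i + v * r i) * f i)"
      by (simp add: q(1) r(1) scaleR_conv_of_real sum_distrib_left sum.distrib algebra_simps)
    moreover have "(\<Sum>i<n. u * q i + v * r i) = 1"
      using uv q(3) r(3) by (simp add: sum.distrib flip: sum_distrib_left)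
    ultimately show "u *\<^sub>R z + v *\<^sub>R w \<in> K"
      using uv q(2) r(2) unfolding K_def by (intro CollectI exI[of _ "\<lambda>i. u * q i + v * r i"]) auto
  qed
  moreover have "f ` {..<n} \<subseteq> K"
  proof safe
    fix j assume "j < n"
    moreover have "(\<Sum>i<n. complex_of_real (if i = j then 1 else 0) * f i) = (\<Sum>i<n. if i = j then f i else 0)"
      by (intro sum.cong) auto
    ultimately show "f j \<in> K"
      unfolding K_def by (intro CollectI exI[of _ "\<lambda>i. if i = j then 1 else 0"]) auto
  qed
  ultimately have sub: "convex hull (f ` {..<n}) \<subseteq> K" by (intro hull_minimal)
  have "compact (convex hull (f ` {..<n}))" by (intro finite_imp_compact_convex_hull) auto
  then have "closed (convex hull (f ` {..<n}))" by (rule compact_imp_closed)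
  moreover have "convex hull (f ` {..<n}) \<noteq> {}" using assms by auto
  ultimately obtain z where z: "z \<in> convex hull (f ` {..<n})"
    and min: "\<And>y. y \<in> convex hull (f ` {..<n}) \<Longrightarrow> dist 0 z \<le> dist 0 y"
    by (rule distance_attains_inf) blast
  obtain q where q: "z = (\<Sum>i<n. complex_of_real (q i) * f i)" "\<forall>i<n. 0 \<le> q i" "(\<Sum>i<n. q i) = 1"
    using z sub by (auto simp: K_def)
  show ?thesis
  proof (rule that)
    fix q' :: "nat \<Rightarrow> real" assume q': "\<And>i. i < n \<Longrightarrow> 0 \<le> q' i" "(\<Sum>i<n. q' i) = 1"
    have "(\<Sum>i<n. q' i *\<^sub>R f i) \<in> convex hull (f ` {..<n})"
      by (rule convex_sum) (auto simp: q' hull_inc)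
    from min[OF this] show "cmod (\<Sum>i<n. complex_of_real (q i) * f i) \<le> cmod (\<Sum>i<n. complex_of_real (q' i) * f i)"
      by (simp add: q(1) scaleR_conv_of_real)
  qed (use q in auto)
qed

subsection \<open>Tensoring with an ancilla\<close>

lemma sum_lessThan_mult:
  fixes f :: "nat \<Rightarrow> 'a::comm_monoid_add"
  shows "(\<Sum>p<m * k. f p) = (\<Sum>i<m. \<Sum>j<k. f (i * k + j))"
proof -
  have "sum f {i * k..<i * k + k} = (\<Sum>j<k. f (i * k + j))" for i
    using sum.shift_bounds_nat_ivl[of f 0 "i * k" k] by (simp add: add.commute atLeast0LessThan)
  then show ?thesis by (simp flip: sum.nat_group)
qed

text \<open>The Kronecker product of \<open>A\<close> with the identity of size \<open>k\<close>, in
  the index order of \<open>apply_A\<close>: the quotient by \<open>k\<close> is the system index,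
  the remainder the ancilla index.\<close>

definition tensor_id :: "complex mat \<Rightarrow> nat \<Rightarrow> nat \<Rightarrow> complex mat" where
  "tensor_id A d k = Matrix.mat (d * k) (d * k) (\<lambda>(p,q).
     if p mod k = q mod k then A $$ (p div k, q div k) else 0)"

lemma tensor_id_carrier [simp]: "tensor_id A d k \<in> carrier_mat (d * k) (d * k)"
  by (simp add: tensor_id_def)

lemma div_less_mult: "p < d * k \<Longrightarrow> p div k < d" for p :: nat
  by (simp add: less_mult_imp_div_less)

lemma mod_less_mult: "p < d * k \<Longrightarrow> p mod k < k" for p :: nat
  by (cases "k = 0") auto

lemma mult_add_less_mult:
  fixes i j k d :: nat
  assumes "i < d" "j < k"
  shows "i * k + j < d * k"
proof -
  have "i * k + j < Suc i * k" using assms by simp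
  also have "\<dots> \<le> d * k" using assms by (intro mult_right_mono) auto
  finally show ?thesis .
qed

lemma tensor_id_mult:
  assumes A: "A \<in> carrier_mat d d" and B: "B \<in> carrier_mat d d"
  shows "tensor_id A d k * tensor_id B d k = tensor_id (A * B) d k"
proof (rule eq_matI)
  fix p q assume "p < dim_row (tensor_id (A * B) d k)" "q < dim_col (tensor_id (A * B) d k)"
  then have pq: "p < d * k" "q < d * k" by (simp_all add: tensor_id_def)
  have "(tensor_id A d k * tensor_id B d k) $$ (p,q)
      = (\<Sum>r<d * k. tensor_id A d k $$ (p,r) * tensor_id B d k $$ (r,q))"
    using pq by (intro mat_mult_index[of _ "d * k" "d * k" _ "d * k"]) auto
  also have "\<dots> = (\<Sum>i<d. \<Sum>j<k. if j = p mod k then (if p mod k = q mod k then A $$ (p div k, i) * B $$ (i, q div k) else 0) else 0)"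
    unfolding sum_lessThan_mult using pq mult_add_less_mult by (intro sum.cong) (auto simp: tensor_id_def)
  also have "\<dots> = (\<Sum>i<d. if p mod k = q mod k then A $$ (p div k, i) * B $$ (i, q div k) else 0)"
    using mod_less_mult[OF pq(1)] by simp
  also have "\<dots> = tensor_id (A * B) d k $$ (p,q)"
    using pq A B div_less_mult[OF pq(1)] div_less_mult[OF pq(2)]
    by (auto simp: tensor_id_def mat_mult_index[of _ d d _ d] simp del: index_mult_mat(1))
  finally show "(tensor_id A d k * tensor_id B d k) $$ (p,q) = tensor_id (A * B) d k $$ (p,q)" .
qed (auto simp: tensor_id_def)

lemma tensor_id_adjoint:
  assumes "A \<in> carrier_mat d d"
  shows "mat_adjoint (tensor_id A d k) = tensor_id (mat_adjoint A) d k"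
  using assms by (intro eq_matI) (auto simp: tensor_id_def div_less_mult)

text \<open>The ancilla repeats every eigenvalue \<open>k\<close> times and adds no new one; this is
  what makes entanglement useless here.\<close>

lemma tensor_id_diag: "tensor_id (mat_diag d l) d k = mat_diag (d * k) (\<lambda>p. l (p div k))"
proof (rule eq_matI)
  fix p q assume "p < dim_row (mat_diag (d * k) (\<lambda>p. l (p div k)))" "q < dim_col (mat_diag (d * k) (\<lambda>p. l (p div k)))"
  then have "p < d * k" "q < d * k" by (simp_all add: mat_diag_def)
  moreover have "p = q" if "p mod k = q mod k" "p div k = q div k"
    using that by (metis div_mult_mod_eq)
  ultimately show "tensor_id (mat_diag d l) d k $$ (p,q) = mat_diag (d * k) (\<lambda>p. l (p div k)) $$ (p,q)"
    by (auto simp: tensor_id_def mat_diag_def div_less_mult)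
qed (auto simp: tensor_id_def mat_diag_def)

lemma unitary_mat_tensor_id:
  assumes "unitary_mat d V"
  shows "unitary_mat (d * k) (tensor_id V d k)"
proof -
  note VD = unitary_matD[OF assms]
  have "tensor_id (1\<^sub>m d) d k = 1\<^sub>m (d * k)"
    using tensor_id_diag[of d "\<lambda>_. 1" k] by simp
  then show ?thesis using VD by (simp add: unitary_mat_def tensor_id_adjoint tensor_id_mult)
qed

section \<open>The channels, with and without ancilla\<close>

lemma mat_triple_index:
  assumes "A \<in> carrier_mat n n" "X \<in> carrier_mat n n" "B \<in> carrier_mat n n" "p < n" "q < n"
  shows "(A * X * B) $$ (p,q) = (\<Sum>i<n. \<Sum>j<n. A $$ (p,i) * X $$ (i,j) * B $$ (j,q))"
proof -
  have "(A * X * B) $$ (p,q) = (\<Sum>j<n. (\<Sum>i<n. A $$ (p,i) * X $$ (i,j)) * B $$ (j,q))"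
    using assms by (simp add: mat_mult_index[of _ n n _ n] del: index_mult_mat(1))
  also have "\<dots> = (\<Sum>i<n. \<Sum>j<n. A $$ (p,i) * X $$ (i,j) * B $$ (j,q))"
    unfolding sum_distrib_right by (rule sum.swap)
  finally show ?thesis .
qed

text \<open>Extending by an ancilla stays inside the same family of channels, so one estimate valid
  in every dimension serves both kinds of probe.\<close>

lemma apply_A_J_chan:
  assumes U: "U \<in> carrier_mat d d" and X: "X \<in> carrier_mat (d * k) (d * k)"
  shows "apply_A (J_chan U r) d k X = J_chan (tensor_id U d k) r X"
proof (rule eq_matI)
  let ?K = "tensor_id U d k"
  fix p q assume "p < dim_row (J_chan ?K r X)" "q < dim_col (J_chan ?K r X)"
  then have pq: "p < d * k" "q < d * k" by (simp_all add: J_chan_def tensor_id_def)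
  note dl = div_less_mult[OF pq(1)] div_less_mult[OF pq(2)] and ml = mod_less_mult[OF pq(1)] mod_less_mult[OF pq(2)]
  \<comment> \<open>The block of \<open>X\<close> whose ancilla indices are fixed by
    \<open>p\<close> and \<open>q\<close>; \<open>apply_A\<close> lets the channel act on exactly
    this block.\<close>
  define Y where "Y = Matrix.mat d d (\<lambda>(i,j). X $$ (i * k + p mod k, j * k + q mod k))"
  have Y: "Y \<in> carrier_mat d d" by (simp add: Y_def)
  have "(?K * X * mat_adjoint ?K) $$ (p,q)
      = (\<Sum>i<d. \<Sum>b<k. \<Sum>j<d. \<Sum>c<k. ?K $$ (p,i * k + b) * X $$ (i * k + b, j * k + c) * mat_adjoint ?K $$ (j * k + c, q))"
    using pq X by (subst mat_triple_index[of _ "d * k"]) (auto simp: sum_lessThan_mult)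
  \<comment> \<open>The identity factors in \<open>?K\<close> and its adjoint force \<open>b\<close>
    and \<open>c\<close> to be the ancilla indices of \<open>p\<close> and \<open>q\<close>, so two
    of the four sums collapse.\<close>
  also have "\<dots> = (\<Sum>i<d. \<Sum>b<k. \<Sum>j<d. \<Sum>c<k. if c = q mod k then
      (if b = p mod k then U $$ (p div k, i) * X $$ (i * k + b, j * k + c) * cnj (U $$ (q div k, j)) else 0) else 0)"
    using pq mult_add_less_mult by (intro sum.cong) (auto simp: tensor_id_def)
  also have "\<dots> = (\<Sum>i<d. \<Sum>j<d. U $$ (p div k, i) * X $$ (i * k + p mod k, j * k + q mod k) * cnj (U $$ (q div k, j)))"
  proof (rule sum.cong[OF refl])
    fix i assume "i \<in> {..<d}"
    have "(\<Sum>b<k. \<Sum>j<d. \<Sum>c<k. if c = q mod k then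
      (if b = p mod k then U $$ (p div k, i) * X $$ (i * k + b, j * k + c) * cnj (U $$ (q div k, j)) else 0) else 0)
     = (\<Sum>j<d. \<Sum>b<k. if b = p mod k then U $$ (p div k, i) * X $$ (i * k + b, j * k + q mod k) * cnj (U $$ (q div k, j)) else 0)"
      using ml by (subst sum.swap) simp
    then show "(\<Sum>b<k. \<Sum>j<d. \<Sum>c<k. if c = q mod k then
      (if b = p mod k then U $$ (p div k, i) * X $$ (i * k + b, j * k + c) * cnj (U $$ (q div k, j)) else 0) else 0)
     = (\<Sum>j<d. U $$ (p div k, i) * X $$ (i * k + p mod k, j * k + q mod k) * cnj (U $$ (q div k, j)))"
      using ml by simp
  qed
  also have "\<dots> = (U * Y * mat_adjoint U) $$ (p div k, q div k)"
    using dl U Y by (subst mat_triple_index[of _ d]) (auto simp: Y_def)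
  finally have K: "(?K * X * mat_adjoint ?K) $$ (p,q) = (U * Y * mat_adjoint U) $$ (p div k, q div k)" .
  have "apply_A (J_chan U r) d k X $$ (p,q) = J_chan U r Y $$ (p div k, q div k)"
    using pq by (simp add: apply_A_def Y_def)
  also have "\<dots> = complex_of_real r * Y $$ (p div k, q div k) + complex_of_real (1 - r) * (U * Y * mat_adjoint U) $$ (p div k, q div k)"
    using dl U Y by (simp add: J_chan_def del: index_mult_mat(1))
  also have "Y $$ (p div k, q div k) = X $$ (p,q)" using dl by (simp add: Y_def)
  also have "complex_of_real r * X $$ (p,q) + complex_of_real (1 - r) * (U * Y * mat_adjoint U) $$ (p div k, q div k)
      = J_chan ?K r X $$ (p,q)"
    unfolding K[symmetric] using pq X carrier_matD[OF tensor_id_carrier[of U d k]]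
    by (simp add: J_chan_def del: index_mult_mat(1))
  finally show "apply_A (J_chan U r) d k X $$ (p,q) = J_chan ?K r X $$ (p,q)" .
qed (auto simp: apply_A_def J_chan_def tensor_id_def)

lemma J_chan_diff:
  assumes "U \<in> carrier_mat n n" "\<rho> \<in> carrier_mat n n"
  shows "J_chan U r1 \<rho> - J_chan U r2 \<rho> = complex_of_real (r1 - r2) \<cdot>\<^sub>m (\<rho> - U * \<rho> * mat_adjoint U)"
  using assms unfolding J_chan_def
  by (intro eq_matI) (auto simp: algebra_simps simp del: index_mult_mat(1))

text \<open>The weights are the squared moduli in a column of the unitary
  \<open>mat_adjoint S * R\<close>, so they sum to 1: the numerical range of a normal matrix lies in
  the convex hull of its eigenvalues.\<close>

lemma unitary_conj_diag_entry:
  assumes S: "unitary_mat n S" and R: "unitary_mat n R" and m: "m < n"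
  shows "(mat_adjoint R * ((S * mat_diag n w * mat_adjoint S) * R)) $$ (m,m)
    = (\<Sum>i<n. complex_of_real ((cmod ((mat_adjoint S * R) $$ (i,m)))\<^sup>2) * w i)"
proof -
  define Y where "Y = mat_adjoint S * R"
  note SD [simp] = unitary_matD[OF S] and RD [simp] = unitary_matD[OF R]
  have Y: "Y \<in> carrier_mat n n" by (simp add: Y_def)
  have "mat_adjoint R * ((S * mat_diag n w * mat_adjoint S) * R) = mat_adjoint Y * (mat_diag n w * Y)"
    by (simp add: Y_def mat_adjoint_mult[of _ n n _ n] assoc_mult_mat[of _ n n _ n _ n])
  also have "(mat_adjoint Y * (mat_diag n w * Y)) $$ (m,m) = (\<Sum>i<n. cnj (Y $$ (i,m)) * (w i * Y $$ (i,m)))"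
    using m Y by (subst mat_mult_index[of _ n n _ n]) (auto simp: mat_diag_mult_left[of _ n n] simp del: index_mult_mat(1))
  also have "\<dots> = (\<Sum>i<n. complex_of_real ((cmod (Y $$ (i,m)))\<^sup>2) * w i)"
    by (simp add: complex_norm_square mult_ac del: of_real_power)
  finally show ?thesis by (simp add: Y_def)
qed

section \<open>The optimal probe and its comparison with all others\<close>

theorem theorem4:
  fixes d :: nat and U :: "complex mat" and r1 r2 :: real
  assumes "d \<ge> 2" and "unitary_mat d U"
    and "r1 \<in> {0..1}" and "r2 \<in> {0..1}"
  shows "\<exists>\<rho>. density d \<rho> \<and>
           (\<forall>\<sigma>. density d \<sigma> \<longrightarrow> succ_single (J_chan U r1) (J_chan U r2) \<sigma>
                                   \<le> succ_single (J_chan U r1) (J_chan U r2) \<rho>) \<and>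
           (\<forall>d' :: nat. \<forall>\<rho>AB. d' \<ge> 1 \<longrightarrow> density (d * d') \<rho>AB \<longrightarrow>
              succ_ent (J_chan U r1) (J_chan U r2) d d' \<rho>AB
                \<le> succ_single (J_chan U r1) (J_chan U r2) \<rho>)"
proof -
  note U = \<open>unitary_mat d U\<close>
  note UD [simp] = unitary_matD[OF U]
  obtain T u where T: "unitary_mat d T" and UT: "U = T * mat_diag d u * mat_adjoint T"
    using normal_mat_unitarily_diagonalizable[OF UD(1)] by auto
  note TD [simp] = unitary_matD[OF T]
  obtain q where q: "\<And>i. i < d \<Longrightarrow> 0 \<le> q i" "(\<Sum>i<d. q i) = 1"
    and q_min: "\<And>q'. (\<And>i. i < d \<Longrightarrow> 0 \<le> q' i) \<Longrightarrow> (\<Sum>i<d. q' i) = 1 \<Longrightarrow>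
       cmod (\<Sum>i<d. complex_of_real (q i) * u i) \<le> cmod (\<Sum>i<d. complex_of_real (q' i) * u i)"
    using convex_combination_min_cmod[of d u] \<open>d \<ge> 2\<close> by auto
  define a where "a = (\<Sum>i<d. complex_of_real (q i) * u i)"
  \<comment> \<open>Amplitudes of the optimal probe in the eigenbasis of \<open>U\<close>: their
    squares are the weights \<open>q\<close>, so the expectation of \<open>U\<close> is
    \<open>a\<close>. \<open>P0\<close> below projects onto this vector.\<close>
  define s where "s i = complex_of_real (sqrt (q i))" for i
  have ss: "s i * s i = complex_of_real (q i)" if "i < d" for i
    using q(1)[OF that] by (simp add: s_def flip: of_real_mult)
  define P0 where "P0 = Matrix.mat d d (\<lambda>(i,j). s i * s j)"
  have P0 [simp]: "P0 \<in> carrier_mat d d" by (simp add: P0_def)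
  \<comment> \<open>Compressing a diagonal matrix by a rank-one projection gives its expectation
    times the projection. Taking \<open>w\<close> constantly 1 yields idempotence of
    \<open>P\<close>, taking \<open>u\<close> yields the overlap \<open>a\<close>.\<close>
  have P0D: "P0 * (mat_diag d w * P0) = (\<Sum>i<d. complex_of_real (q i) * w i) \<cdot>\<^sub>m P0" for w
  proof (rule eq_matI)
    fix i j assume "i < dim_row ((\<Sum>i<d. complex_of_real (q i) * w i) \<cdot>\<^sub>m P0)" "j < dim_col ((\<Sum>i<d. complex_of_real (q i) * w i) \<cdot>\<^sub>m P0)"
    then have ij: "i < d" "j < d" by (simp_all add: P0_def)
    have "(P0 * (mat_diag d w * P0)) $$ (i,j) = (\<Sum>k<d. s i * s k * (w k * (s k * s j)))"
      using ij by (subst mat_mult_index[of _ d d _ d]) (auto simp: mat_diag_mult_left[of _ d d] P0_def simp del: index_mult_mat(1))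
    also have "\<dots> = (\<Sum>k<d. (s k * s k) * w k * (s i * s j))" by (simp add: mult_ac)
    also have "\<dots> = (\<Sum>k<d. complex_of_real (q k) * w k) * (s i * s j)"
      unfolding sum_distrib_right by (intro sum.cong) (auto simp: ss)
    finally show "(P0 * (mat_diag d w * P0)) $$ (i,j) = ((\<Sum>i<d. complex_of_real (q i) * w i) \<cdot>\<^sub>m P0) $$ (i,j)"
      using ij by (simp add: P0_def)
  qed (auto simp: P0_def)
  have sum_q: "(\<Sum>i<d. complex_of_real (q i)) = 1" using q(2) by (metis of_real_1 of_real_sum)
  note assoc = assoc_mult_mat[of _ d d _ d _ d] and cancel = mult_left_cancel_mat[of _ _ d]
  define P where "P = T * P0 * mat_adjoint T"
  have Pc [simp]: "P \<in> carrier_mat d d" by (simp add: P_def)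
  have P0adj: "mat_adjoint P0 = P0"
    by (rule eq_matI) (auto simp: P0_def s_def)
  have Padj: "mat_adjoint P = P" by (simp add: P_def P0adj mat_adjoint_mult[of _ d d _ d] assoc)
  have P0C: "P0 * (mat_diag d w * (P0 * C)) = (\<Sum>i<d. complex_of_real (q i) * w i) \<cdot>\<^sub>m (P0 * C)"
    if "C \<in> carrier_mat d d" for w C
  proof -
    have "P0 * (mat_diag d w * (P0 * C)) = (P0 * (mat_diag d w * P0)) * C" using that by (simp add: assoc)
    then show ?thesis using that by (simp add: P0D mult_smult_assoc_mat[of _ d d _ d])
  qed
  have PP: "P * P = P"
    using P0C[of "mat_adjoint T" "\<lambda>_. 1"] by (simp add: P_def assoc cancel sum_q left_mult_one_mat[of _ d d])
  have PUP: "P * (U * P) = a \<cdot>\<^sub>m P"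
    by (simp add: P_def UT assoc cancel P0C a_def mult_smult_distrib[of _ d d _ d])
  have trP: "mtrace P = 1"
  proof -
    have "mtrace P = mtrace (mat_adjoint T * (T * P0))"
      unfolding P_def by (intro mtrace_mult_comm[of _ d d]) auto
    also have "\<dots> = (\<Sum>i<d. s i * s i)" by (simp add: cancel) (simp add: P0_def mtrace_def)
    also have "\<dots> = (\<Sum>i<d. complex_of_real (q i))" by (intro sum.cong) (auto simp: ss)
    finally show ?thesis by (simp add: sum_q)
  qed
  \<comment> \<open>A self-adjoint idempotent equals \<open>mat_adjoint P * P\<close>, hence is
    positive.\<close>
  have dens: "density d P"
    using psd_adjoint_mult_self[OF Pc, of 1] by (simp add: density_def Padj PP trP)
  define t where "t = r1 - r2"
  have lower: "2 * \<bar>t\<bar> * sqrt (1 - (cmod a)\<^sup>2) \<le> trace_norm (J_chan U r1 P - J_chan U r2 P)"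
    unfolding J_chan_diff[OF UD(1) Pc] t_def
    by (rule trace_norm_projection_unitary_conj_ge[OF Pc Padj PP trP U PUP])
  have upper_ent: "trace_norm (apply_A (J_chan U r1) d k \<sigma> - apply_A (J_chan U r2) d k \<sigma>) \<le> 2 * \<bar>t\<bar> * sqrt (1 - (cmod a)\<^sup>2)"
    if \<sigma>: "density (d * k) \<sigma>" for k \<sigma>
  proof -
    have \<sigma>c: "\<sigma> \<in> carrier_mat (d * k) (d * k)" using \<sigma> by (auto simp: density_def psd_def)
    let ?S = "tensor_id T d k"
    have S: "unitary_mat (d * k) ?S" by (rule unitary_mat_tensor_id[OF T])
    have W: "tensor_id U d k = ?S * mat_diag (d * k) (\<lambda>p. u (p div k)) * mat_adjoint ?S"
      by (simp add: UT tensor_id_adjoint tensor_id_mult flip: tensor_id_diag)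
    have "cmod a \<le> cmod ((mat_adjoint R * (tensor_id U d k * R)) $$ (m,m))"
      if R: "unitary_mat (d * k) R" and m: "m < d * k" for R m
    proof -
      define y where "y p = (cmod ((mat_adjoint ?S * R) $$ (p,m)))\<^sup>2" for p
      have y: "(\<Sum>p<d * k. y p) = 1"
        unfolding y_def by (rule unitary_mat_col[OF unitary_mat_mult[OF unitary_mat_adjoint[OF S] R] m])
      have "(mat_adjoint R * (tensor_id U d k * R)) $$ (m,m) = (\<Sum>p<d * k. complex_of_real (y p) * u (p div k))"
        unfolding W y_def by (rule unitary_conj_diag_entry[OF S R m])
      \<comment> \<open>Summing the weights over the ancilla index leaves a convex combination of
        the same \<open>u i\<close>, which competes in \<open>q_min\<close>.\<close>
      also have "\<dots> = (\<Sum>i<d. complex_of_real (\<Sum>j<k. y (i * k + j)) * u i)"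
        unfolding sum_lessThan_mult by (intro sum.cong) (auto simp: sum_distrib_right)
      finally show ?thesis
        using q_min[of "\<lambda>i. \<Sum>j<k. y (i * k + j)"] y unfolding sum_lessThan_mult a_def
        by (simp add: y_def sum_nonneg)
    qed
    then show ?thesis
      unfolding apply_A_J_chan[OF UD(1) \<sigma>c] J_chan_diff[OF tensor_id_carrier \<sigma>c] t_def
      by (intro trace_norm_unitary_conj_diff_le[where n = "d * k"] unitary_mat_tensor_id U \<sigma>) auto
  qed
  have upper: "trace_norm (J_chan U r1 \<sigma> - J_chan U r2 \<sigma>) \<le> 2 * \<bar>t\<bar> * sqrt (1 - (cmod a)\<^sup>2)"
    if \<sigma>: "density d \<sigma>" for \<sigma>
  proof -
    have \<sigma>c: "\<sigma> \<in> carrier_mat d d" using \<sigma> by (auto simp: density_def psd_def)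
    \<comment> \<open>A single-system probe is a probe with an ancilla of dimension 1.\<close>
    have "tensor_id U d 1 = U" using carrier_matD[OF UD(1)] by (intro eq_matI) (auto simp: tensor_id_def)
    then show ?thesis using upper_ent[of 1 \<sigma>] \<sigma> \<sigma>c by (simp add: apply_A_J_chan)
  qed
  show ?thesis
    unfolding succ_single_def succ_ent_def
    using dens order_trans[OF upper lower] order_trans[OF upper_ent lower] by (intro exI[of _ P]) auto
qed

end
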